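(* Let $n,p\in\mathbb R$ with $0<p<n$, let $\alpha\in(-1,1)$ and $N\in\mathbb N_0$. Let $k(x,y)=\sum_{w=0}^N Q_w^*(x)Q_w(y)$, where $\{Q_w\}_{w\ge0}$ are the matrix orthonormal polynomials with respect to $W=W_{p,n}$. Then the differential operator $$\tilde D= \frac{d^2}{dx^2}(x^2-1)(x-\alpha)+\frac{d}{dx}\Big((n+3)x^2-\alpha(n+2)x-1+2(x-\alpha)\begin{pmatrix}0&1\\1&0\end{pmatrix}\Big)+\Big(-N(N+n+2)x+\alpha(n-2p)\begin{pmatrix}1&0\\0&0\end{pmatrix}+\begin{pmatrix}0&n-p+1\\ p+1&0\end{pmatrix}\Big),$$ acting from the right hand side, satisfies $$\big(k(x,y)^*\big)\tilde D_x=\big(k(x,y)\tilde D_y\big)^*\qquad\text{for all }x,y.$$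
   Context: $W$ is the $2\times2$ matrix weight $$W(x)=W_{p,n}(x)=(1-x^2)^{\frac n2-1}\begin{pmatrix}p x^2+n-p&-nx\\-nx&(n-p)x^2+p\end{pmatrix},\qquad x\in[-1,1].$$ $\{R_w\}_{w\ge0}$ is the sequence of monic matrix orthogonal polynomials with respect to $W$: $R_w$ is a $2\times2$ matrix polynomial of degree $w$ with leading coefficient the identity and $\int_{-1}^1R_w(x)W(x)R_{v}^*(x)\,dx=0$ for $w\ne v$. Explicitly, $$R_w(x)=\frac{w!\,(n+1)}{2^w(\frac{n+1}2)_w}\begin{pmatrix}\frac1{n+1}C_w^{\frac{n+1}2}(x)+\frac1{p+w}C_{w-2}^{\frac{n+3}2}(x)&\frac1{p+w}C_{w-1}^{\frac{n+3}2}(x)\\ \frac1{n-p+w}C_{w-1}^{\frac{n+3}2}(x)&\frac1{n+1}C_w^{\frac{n+1}2}(x)+\frac1{n-p+w}C_{w-2}^{\frac{n+3}2}(x)\end{pmatrix},$$ where $C_j^\lambda$ is the $j$-th Gegenbauer polynomial ($C_j^\lambda=0$ for $j<0$) and $(a)_w$ is the Pochhammer symbol (rising factorial). The matrix $\|R_w\|^2=\int_{-1}^1R_w(x)W(x)R_w^*(x)\,dx$ is diagonal and positive definite, $\|R_w\|$ is its positive definite square root, and $Q_w=\|R_w\|^{-1}R_w$. A differential operator $\frac{d^2}{dx^2}F_2(x)+\frac{d}{dx}F_1(x)+F_0(x)$ acts from the right hand side: it sends $f$ to $f''(x)F_2(x)+f'(x)F_1(x)+f(x)F_0(x)$; scalars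 are understood as multiples of the identity matrix. $\tilde D_x$ (respectively $\tilde D_y$) means that $\tilde D$ acts from the right on the variable $x$ (respectively $y$, with coefficients evaluated at $y$), the other variable being held fixed. $A^*$ denotes the (conjugate) transpose. *)

theory Defs
  imports "HOL-Analysis.Analysis"
begin

definition mat2 :: "real \<Rightarrow> real \<Rightarrow> real \<Rightarrow> real \<Rightarrow> real^2^2" where
  "mat2 a b c d = vector [vector [a, b], vector [c, d]]"

text \<open>Only the values on \<open>[-1, 1]\<close> matter. The real power satisfies \<open>0 powr a = 0\<close> for every
  \<open>a\<close>, so this vanishes at the end points, where the weight may be singular; this does not affect
  integrals.\<close>

definition weight :: "real \<Rightarrow> real \<Rightarrow> real \<Rightarrow> real^2^2" where
  "weight p n x = ((1 - x\<^sup>2) powr (n / 2 - 1)) *\<^sub>R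
     mat2 (p * x\<^sup>2 + n - p) (- n * x) (- n * x) ((n - p) * x\<^sup>2 + p)"

text \<open>All matrices are real, so the conjugate transpose is the transpose.\<close>

definition matrix_inner ::
    "(real \<Rightarrow> real^2^2) \<Rightarrow> (real \<Rightarrow> real^2^2) \<Rightarrow> (real \<Rightarrow> real^2^2) \<Rightarrow> real^2^2" where
  "matrix_inner W P Q = integral {-1..1} (\<lambda>x. P x ** W x ** transpose (Q x))"

definition monic_matrix_poly :: "nat \<Rightarrow> (real \<Rightarrow> real^2^2) \<Rightarrow> bool" where
  "monic_matrix_poly w P \<longleftrightarrow>
     (\<exists>c :: nat \<Rightarrow> real^2^2. c w = mat 1 \<and> (\<forall>x. P x = (\<Sum>i\<le>w. x ^ i *\<^sub>R c i)))"

definition monic_orthogonal_polys :: "(real \<Rightarrow> real^2^2) \<Rightarrow> (nat \<Rightarrow> real \<Rightarrow> real^2^2) \<Rightarrow> bool" where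
  "monic_orthogonal_polys W R \<longleftrightarrow>
     (\<forall>w. monic_matrix_poly w (R w)) \<and> (\<forall>w v. w \<noteq> v \<longrightarrow> matrix_inner W (R w) (R v) = 0)"

definition pos_def :: "real^2^2 \<Rightarrow> bool" where
  "pos_def A \<longleftrightarrow> transpose A = A \<and> (\<forall>v. v \<noteq> 0 \<longrightarrow> v \<bullet> (A *v v) > 0)"

definition pos_def_sqrt :: "real^2^2 \<Rightarrow> real^2^2" where
  "pos_def_sqrt A = (THE S. pos_def S \<and> S ** S = A)"

definition matrix_norm :: "(real \<Rightarrow> real^2^2) \<Rightarrow> (real \<Rightarrow> real^2^2) \<Rightarrow> real^2^2" where
  "matrix_norm W P = pos_def_sqrt (matrix_inner W P P)"

definition orthonormalize ::
    "(real \<Rightarrow> real^2^2) \<Rightarrow> (nat \<Rightarrow> real \<Rightarrow> real^2^2) \<Rightarrow> nat \<Rightarrow> real \<Rightarrow> real^2^2" where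
  "orthonormalize W R w x = matrix_inv (matrix_norm W (R w)) ** R w x"

definition kernel :: "(nat \<Rightarrow> real \<Rightarrow> real^2^2) \<Rightarrow> nat \<Rightarrow> real \<Rightarrow> real \<Rightarrow> real^2^2" where
  "kernel Q N x y = (\<Sum>w\<le>N. transpose (Q w x) ** Q w y)"

text \<open>The operator \<open>d\<^sup>2/dx\<^sup>2 F2 + d/dx F1 + F0\<close>, acting from the right on \<open>f\<close>, evaluated at \<open>x\<close>.\<close>

definition right_diff_op ::
    "(real \<Rightarrow> real^2^2) \<Rightarrow> (real \<Rightarrow> real^2^2) \<Rightarrow> (real \<Rightarrow> real^2^2) \<Rightarrow>
     (real \<Rightarrow> real^2^2) \<Rightarrow> real \<Rightarrow> real^2^2" where
  "right_diff_op F2 F1 F0 f x =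
     vector_derivative (\<lambda>s. vector_derivative f (at s)) (at x) ** F2 x
     + vector_derivative f (at x) ** F1 x
     + f x ** F0 x"

text \<open>A scalar \<open>c\<close> in an operator coefficient is \<open>mat c\<close>, that is, \<open>c\<close> times the identity matrix.\<close>

definition D_tilde ::
    "real \<Rightarrow> real \<Rightarrow> real \<Rightarrow> nat \<Rightarrow> (real \<Rightarrow> real^2^2) \<Rightarrow> real \<Rightarrow> real^2^2" where
  "D_tilde p n \<alpha> N = right_diff_op
     (\<lambda>x. mat ((x\<^sup>2 - 1) * (x - \<alpha>)))
     (\<lambda>x. mat ((n + 3) * x\<^sup>2 - \<alpha> * (n + 2) * x - 1) + (2 * (x - \<alpha>)) *\<^sub>R mat2 0 1 1 0)
     (\<lambda>x. mat (- real N * (real N + n + 2) * x) + (\<alpha> * (n - 2 * p)) *\<^sub>R mat2 1 0 0 0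
          + mat2 0 (n - p + 1) (p + 1) 0)"

end

theory Submission
  imports Defs
begin

text \<open>
  Write \<open>\<langle>P, Q\<rangle>\<close> for the integral of \<open>P W Q\<^sup>*\<close> over \<open>[-1, 1]\<close> and \<open>P D\<close> for the operator \<open>D\<close> of the
  theorem, applied to \<open>P\<close>. The theorem is the commutation of \<open>D\<close> with the projection onto the
  polynomials of degree at most \<open>N\<close>, read off from the kernel of that projection. It rests on two
  facts.

  The operator is symmetric: \<open>\<langle>P D, Q\<rangle> = \<langle>P, Q D\<rangle>\<close> for all twice continuously differentiable \<open>P\<close> and
  \<open>Q\<close>. The reason is a Lagrange identity: \<open>(P D) W Q\<^sup>* - P W (Q D)\<^sup>*\<close> is the derivative of an
  explicit concomitant that carries the factor \<open>(1 - x\<^sup>2)\<close> to the power \<open>n / 2 > 0\<close>, hence is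
  continuous on the closed interval and vanishes at both end points (lemmas
  \<open>Lagrange_identity\<close> and \<open>D_tilde_symmetric\<close>).

  The operator maps matrix polynomials of degree at most \<open>N\<close> to such polynomials, although its
  coefficients have degree one more than that of a degree-preserving operator: on \<open>x\<^sup>i\<close> the
  coefficient of \<open>x\<close> to the power \<open>i + 1\<close> is the scalar \<open>i (i + n + 2) - N (N + n + 2)\<close>, which
  vanishes for \<open>i = N\<close> (lemma \<open>D_tilde_matrix_polys\<close>).

  Consequently \<open>Q\<^sub>w D = \<Sum>\<^sub>v A\<^sub>w\<^sub>v Q\<^sub>v\<close> with \<open>v \<le> N\<close> for each \<open>w \<le> N\<close>, where
  \<open>A\<^sub>w\<^sub>v = \<langle>Q\<^sub>w D, Q\<^sub>v\<rangle>\<close>, and the symmetry says that \<open>A\<^sub>v\<^sub>w\<close> is the transpose of \<open>A\<^sub>w\<^sub>v\<close>. So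
  \<open>\<Sum>\<^sub>w Q\<^sub>w(x)\<^sup>* (Q\<^sub>w D)(y) = \<Sum>\<^sub>w\<^sub>,\<^sub>v Q\<^sub>w(x)\<^sup>* A\<^sub>w\<^sub>v Q\<^sub>v(y)\<close> becomes, when transposed, the same sum with \<open>x\<close>
  and \<open>y\<close> exchanged (lemma \<open>kernel_symmetric_operator\<close>).

  For the normalized polynomials to be orthonormal at all, the matrices \<open>\<langle>R\<^sub>w, R\<^sub>w\<rangle>\<close> must be positive
  definite and have exactly one positive definite square root. The first holds because
  \<open>W\<close> is positive definite on the open interval; the second is an instance of
  the Cayley-Hamilton theorem for matrices of size two.
\<close>

section \<open>Matrices of size two\<close>

lemma mat2_nth:
  "mat2 a b c d $ 1 $ 1 = a" "mat2 a b c d $ 1 $ 2 = b"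
  "mat2 a b c d $ 2 $ 1 = c" "mat2 a b c d $ 2 $ 2 = d"
  by (simp_all add: mat2_def)

lemmas mat2_entry = mat2_nth vec_eq_iff forall_2 matrix_matrix_mult_def sum_2
  transpose_def mat_def

lemma bounded_bilinear_mat2_mult:
  "bounded_bilinear ((**) :: real^2^2 \<Rightarrow> real^2^2 \<Rightarrow> real^2^2)"
  by (rule iffD1[OF bilinear_conv_bounded_bilinear])
     (auto simp: bilinear_def linear_iff vec_eq_iff matrix_matrix_mult_def sum_2 algebra_simps)

lemma bounded_linear_transpose: "bounded_linear (transpose :: real^2^2 \<Rightarrow> real^2^2)"
  by (rule iffD1[OF linear_conv_bounded_linear]) (auto simp: linear_iff vec_eq_iff transpose_def)

lemmas mat2_mult_scaleR =
  bounded_bilinear.scaleR_left[OF bounded_bilinear_mat2_mult]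
  bounded_bilinear.scaleR_right[OF bounded_bilinear_mat2_mult]

text \<open>Sylvester's criterion, by completing the square.\<close>

lemma pos_def_mat2_iff:
  "pos_def A \<longleftrightarrow> A $ 1 $ 2 = A $ 2 $ 1 \<and> A $ 1 $ 1 > 0 \<and> det A > 0"
proof -
  have sym: "transpose A = A \<longleftrightarrow> A $ 1 $ 2 = A $ 2 $ 1"
    by (auto simp: vec_eq_iff transpose_def forall_2)
  define a b d where abd: "a = A $ 1 $ 1" "b = A $ 1 $ 2" "d = A $ 2 $ 2"
  have quad: "v \<bullet> (A *v v) = a * (v $ 1)\<^sup>2 + 2 * b * (v $ 1) * (v $ 2) + d * (v $ 2)\<^sup>2"
    if "A $ 1 $ 2 = A $ 2 $ 1" for v
    using that by (simp add: inner_vec_def matrix_vector_mult_def sum_2 abd power2_eq_square algebra_simps)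
  have det: "det A = a * d - b\<^sup>2" if "A $ 1 $ 2 = A $ 2 $ 1"
    using that by (simp add: det_2 abd power2_eq_square)
  have square: "a * (a * s\<^sup>2 + 2 * b * s * t + d * t\<^sup>2) = (a * s + b * t)\<^sup>2 + (a * d - b\<^sup>2) * t\<^sup>2"
    for s t by (simp add: power2_eq_square algebra_simps)
  show ?thesis
  proof (intro iffI conjI)
    assume A: "pos_def A"
    then show s: "A $ 1 $ 2 = A $ 2 $ 1" using sym by (simp add: pos_def_def)
    have pos: "a * s\<^sup>2 + 2 * b * s * t + d * t\<^sup>2 > 0" if "s \<noteq> 0 \<or> t \<noteq> 0" for s t
    proof -
      have "(vector [s, t] :: real^2) \<noteq> 0" using that by (auto simp: vec_eq_iff forall_2)
      with A quad[OF s, of "vector [s, t]"] show ?thesis by (auto simp: pos_def_def)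
    qed
    from pos[of 1 0] show a: "A $ 1 $ 1 > 0" by (simp add: abd)
    \<comment> \<open>The vector \<open>(b, -a)\<close> annihilates the first square in \<open>square\<close> and leaves the determinant.\<close>
    have "0 < a * (a * b\<^sup>2 + 2 * b * b * (- a) + d * (- a)\<^sup>2)"
      using pos[of b "- a"] a by (simp add: abd power2_eq_square)
    also have "\<dots> = a\<^sup>2 * (a * d - b\<^sup>2)" by (simp add: power2_eq_square algebra_simps)
    finally show "det A > 0" using a det[OF s] by (simp add: zero_less_mult_iff)
  next
    assume R: "A $ 1 $ 2 = A $ 2 $ 1 \<and> A $ 1 $ 1 > 0 \<and> det A > 0"
    then have a: "a > 0" and D: "a * d - b\<^sup>2 > 0" using det by (auto simp: abd)
    have "v \<bullet> (A *v v) > 0" if v: "v \<noteq> 0" for v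
    proof -
      have "v $ 1 \<noteq> 0 \<or> v $ 2 \<noteq> 0" using v by (auto simp: vec_eq_iff forall_2)
      then have "(a * v $ 1 + b * v $ 2)\<^sup>2 + (a * d - b\<^sup>2) * (v $ 2)\<^sup>2 > 0"
      proof (cases "v $ 2 = 0")
        case True with a v \<open>v $ 1 \<noteq> 0 \<or> v $ 2 \<noteq> 0\<close> show ?thesis by simp
      next
        case False with D show ?thesis by (intro add_nonneg_pos) auto
      qed
      then show ?thesis using a quad[of v] R square[of "v $ 1" "v $ 2"]
        by (metis mult_less_cancel_left_pos mult_zero_right)
    qed
    with R sym show "pos_def A" by (auto simp: pos_def_def)
  qed
qed

text \<open>By the Cayley-Hamilton theorem a square root \<open>S\<close> of \<open>A\<close> satisfies \<open>t S = A + r I\<close>, where \<open>t\<close> is the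
  trace and \<open>r\<close> the determinant of \<open>S\<close>. If \<open>S\<close> is positive definite, then \<open>r\<close> is the positive root
  of \<open>det A\<close> and \<open>t\<close> that of \<open>tr A + 2 r\<close>; so \<open>S\<close> is determined by \<open>A\<close>, and this formula defines a
  square root.\<close>

lemma pos_def_sqrt_works:
  assumes A: "pos_def A"
  shows "pos_def (pos_def_sqrt A)" "pos_def_sqrt A ** pos_def_sqrt A = A"
proof -
  define r where "r = sqrt (det A)"
  define t where "t = sqrt (A $ 1 $ 1 + A $ 2 $ 2 + 2 * r)"
  define S where "S = (1 / t) *\<^sub>R (A + mat r)"
  have s: "A $ 1 $ 2 = A $ 2 $ 1" and a: "A $ 1 $ 1 > 0" and D: "det A > 0"
    using A pos_def_mat2_iff by auto
  have r: "r > 0" "r\<^sup>2 = A $ 1 $ 1 * A $ 2 $ 2 - A $ 2 $ 1 * A $ 2 $ 1"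
    using D s by (auto simp: r_def det_2)
  have "A $ 1 $ 1 * A $ 2 $ 2 > 0" using r s by (smt (verit) zero_less_power mult_eq_0_iff zero_le_square)
  then have d: "A $ 2 $ 2 > 0" using a by (simp add: zero_less_mult_iff)
  have t: "t > 0" "t\<^sup>2 = A $ 1 $ 1 + A $ 2 $ 2 + 2 * r"
    using a d r by (auto simp: t_def)
  have SS: "S ** S = A"
  proof -
    have "(A + mat r) ** (A + mat r) = t\<^sup>2 *\<^sub>R A"
      unfolding t(2) using r(2) s by (simp add: mat2_entry power2_eq_square algebra_simps)
    then show ?thesis using t(1)
      by (simp add: S_def mat2_mult_scaleR power2_eq_square)
  qed
  have "pos_def S"
  proof -
    have "det S = ((A $ 1 $ 1 + r) * (A $ 2 $ 2 + r) - A $ 2 $ 1 * A $ 2 $ 1) / t\<^sup>2"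
      using s by (simp add: S_def det_2 mat_def power2_eq_square diff_divide_distrib)
    also have "(A $ 1 $ 1 + r) * (A $ 2 $ 2 + r) - A $ 2 $ 1 * A $ 2 $ 1 = r * t\<^sup>2"
      unfolding t(2) using r(2) by (simp add: power2_eq_square algebra_simps)
    finally have "det S = r" using t(1) by simp
    then show ?thesis using s a r t by (simp add: pos_def_mat2_iff S_def mat_def)
  qed
  moreover have "T = S" if T: "pos_def T" "T ** T = A" for T
  proof -
    have Ts: "T $ 1 $ 2 = T $ 2 $ 1" and Ta: "T $ 1 $ 1 > 0" and TD: "det T > 0"
      using T pos_def_mat2_iff by auto
    have "(det T)\<^sup>2 = det A" using T(2) by (metis det_mul power2_eq_square)
    then have rT: "r = det T" using TD by (simp add: r_def real_sqrt_unique)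
    have "T $ 1 $ 1 * T $ 2 $ 2 > 0" using TD Ts by (simp add: det_2) (smt (verit) zero_le_square)
    then have Td: "T $ 2 $ 2 > 0" using Ta by (simp add: zero_less_mult_iff)
    have "(T $ 1 $ 1 + T $ 2 $ 2)\<^sup>2 = t\<^sup>2"
      unfolding t(2) rT T(2)[symmetric]
      by (simp add: mat2_entry det_2 power2_eq_square algebra_simps)
    then have tT: "t = T $ 1 $ 1 + T $ 2 $ 2" using t(1) Ta Td by (simp add: power2_eq_iff_nonneg)
    have "A + mat r = t *\<^sub>R T"
      unfolding tT rT T(2)[symmetric] by (simp add: mat2_entry det_2 algebra_simps)
    then show "T = S" using t(1) by (simp add: S_def)
  qed
  ultimately have "pos_def_sqrt A = S" using SS unfolding pos_def_sqrt_def by (intro the_equality) blast+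
  with SS \<open>pos_def S\<close> show "pos_def (pos_def_sqrt A)" "pos_def_sqrt A ** pos_def_sqrt A = A" by auto
qed

section \<open>Integrability against the weight\<close>

text \<open>A Beta integral, transported from \<open>[0, 1]\<close> to \<open>[-1, 1]\<close> by \<open>t = (x + 1) / 2\<close>. Absolute
  integrability is what survives the multiplication by a continuous factor.\<close>

lemma integrable_ultraspherical:
  fixes a :: real assumes "a > -1"
  shows "(\<lambda>x. (1 - x\<^sup>2) powr a) absolutely_integrable_on {-1..1}"
proof -
  have "((\<lambda>t. t powr a * (1 - t) powr a) has_integral Beta (a + 1) (a + 1)) (cbox 0 1)"
    using has_integral_Beta_real[of "a + 1" "a + 1"] assms by simp
  from has_integral_affinity'[OF this, of "1/2" "1/2", THEN has_integral_integrable]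
  have "(\<lambda>x. (x / 2 + 1 / 2) powr a * (1 - (x / 2 + 1 / 2)) powr a) integrable_on {-1..1}"
    by simp
  then have "(\<lambda>x. 4 powr a * ((x / 2 + 1 / 2) powr a * (1 - (x / 2 + 1 / 2)) powr a)) integrable_on {-1..1}"
    by (rule integrable_on_mult_right)
  then have "(\<lambda>x. (1 - x\<^sup>2) powr a) integrable_on {-1..1}"
  proof (rule integrable_eq)
    fix x :: real assume "x \<in> {-1..1}"
    then show "4 powr a * ((x / 2 + 1 / 2) powr a * (1 - (x / 2 + 1 / 2)) powr a) = (1 - x\<^sup>2) powr a"
      by (simp add: powr_mult[symmetric] power2_eq_square algebra_simps)
  qed
  then show ?thesis by (rule nonnegative_absolutely_integrable_1) auto
qed

lemma integrable_ultraspherical_scaleR: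
  fixes G :: "real \<Rightarrow> 'a::euclidean_space"
  assumes "a > -1" and G: "continuous_on {-1..1} G"
  shows "(\<lambda>x. (1 - x\<^sup>2) powr a *\<^sub>R G x) integrable_on {-1..1}"
proof -
  have "bilinear (\<lambda>(v :: 'a) c. c *\<^sub>R v)"
    by (auto simp: bilinear_def linear_iff algebra_simps)
  then have "(\<lambda>x. (1 - x\<^sup>2) powr a *\<^sub>R G x) absolutely_integrable_on {-1..1}"
  proof (rule absolutely_integrable_bounded_measurable_product)
    show "G \<in> borel_measurable (lebesgue_on {-1..1})"
      using G by (rule continuous_imp_measurable_on_sets_lebesgue) auto
    show "bounded (G ` {-1..1})"
      using G by (intro compact_imp_bounded compact_continuous_image) auto
  qed (use integrable_ultraspherical[OF assms(1)] in auto)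
  then show ?thesis by (rule set_lebesgue_integral_eq_integral(1))
qed

definition polyweight :: "real \<Rightarrow> real \<Rightarrow> real \<Rightarrow> real^2^2" where
  "polyweight p n x = mat2 (p * x\<^sup>2 + n - p) (- n * x) (- n * x) ((n - p) * x\<^sup>2 + p)"

lemma weight_eq: "weight p n x = (1 - x\<^sup>2) powr (n / 2 - 1) *\<^sub>R polyweight p n x"
  by (simp add: weight_def polyweight_def)

lemma polyweight_expand:
  "polyweight p n = (\<lambda>x. mat2 (n - p) 0 0 p + x *\<^sub>R mat2 0 (- n) (- n) 0 + x\<^sup>2 *\<^sub>R mat2 p 0 0 (n - p))"
  by (auto simp: polyweight_def mat2_entry fun_eq_iff)

lemma polyweight_continuous: "continuous_on S (polyweight p n)"
  unfolding polyweight_expand by (intro continuous_intros)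

lemma polyweight_deriv:
  "(polyweight p n has_vector_derivative mat2 (2 * p * x) (- n) (- n) (2 * (n - p) * x)) (at x)"
  unfolding polyweight_expand by (rule derivative_eq_intros refl | simp add: mat2_entry)+

lemma matrix_inner_integrable:
  fixes P Q :: "real \<Rightarrow> real^2^2"
  assumes "n > 0" "continuous_on {-1..1} P" "continuous_on {-1..1} Q"
  shows "(\<lambda>x. P x ** weight p n x ** transpose (Q x)) integrable_on {-1..1}"
proof -
  have "(\<lambda>x. (1 - x\<^sup>2) powr (n / 2 - 1) *\<^sub>R (P x ** polyweight p n x ** transpose (Q x))) integrable_on {-1..1}"
    using assms by (intro integrable_ultraspherical_scaleR bounded_bilinear.continuous_on[OF bounded_bilinear_mat2_mult]
      bounded_linear.continuous_on[OF bounded_linear_transpose] polyweight_continuous) auto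
  then show ?thesis
    by (simp add: weight_eq mat2_mult_scaleR)
qed

section \<open>Symmetry of the operator\<close>

lemma mat2_mult_entry: "(A ** B) $ i $ j = A $ i $ 1 * B $ 1 $ j + A $ i $ 2 * B $ 2 $ j"
  for A B :: "real^2^2"
  by (simp add: matrix_matrix_mult_def sum_2)

text \<open>
  The Lagrange identity at one point, as an identity of polynomials. Here \<open>(a, b)\<close> and \<open>(r, s)\<close>
  are rows of the two matrix functions, with primes for their derivatives. The form \<open>M\<close> is the
  polynomial part of the weight as a bilinear form in two rows, written as a combination of two
  products, and \<open>M'\<close> is its derivative in \<open>x\<close>. The components of the image of a row under the
  operator are \<open>D1\<close> and \<open>D2\<close>. The skew term \<open>J\<close> comes from the part of \<open>F\<^sub>1 W\<close> that is not symmetric: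
  writing \<open>\<sigma>\<close> for the matrix that exchanges the two coordinates, \<open>\<sigma>\<close> fails to commute with the
  polynomial part of the weight by \<open>(n - 2 p) (1 - x\<^sup>2)\<close> times a constant skew matrix. In the coefficient \<open>c x\<close>
  of order zero the number \<open>c\<close> is arbitrary, as a multiple of the identity is symmetric.
\<close>

lemma Lagrange_identity_rows:
  fixes x p n \<alpha> c :: real
  defines "M \<equiv> \<lambda>a b r s. p * (x * a - b) * (x * r - s) + (n - p) * (a - x * b) * (r - x * s)"
    and "M' \<equiv> \<lambda>a b r s. 2 * p * x * a * r - n * (a * s + b * r) + 2 * (n - p) * x * b * s"
    and "J \<equiv> \<lambda>a b r s. a * s - b * r"
    and "D1 \<equiv> \<lambda>a b a' b' a''. (x\<^sup>2 - 1) * (x - \<alpha>) * a''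
            + (((n + 3) * x\<^sup>2 - \<alpha> * (n + 2) * x - 1) * a' + 2 * (x - \<alpha>) * b')
            + (c * x + \<alpha> * (n - 2 * p)) * a + (p + 1) * b"
    and "D2 \<equiv> \<lambda>a b a' b' b''. (x\<^sup>2 - 1) * (x - \<alpha>) * b''
            + (((n + 3) * x\<^sup>2 - \<alpha> * (n + 2) * x - 1) * b' + 2 * (x - \<alpha>) * a')
            + c * x * b + (n - p + 1) * a"
  shows "M (D1 a b a' b' a'') (D2 a b a' b' b'') r s - M a b (D1 r s r' s' r'') (D2 r s r' s' s'')
      = (n * x * (x - \<alpha>) - (1 - x\<^sup>2)) * (M a' b' r s - M a b r' s' + (n - 2 * p) * J a b r s)
        - (1 - x\<^sup>2) * (x - \<alpha>) * (M a'' b'' r s - M a b r'' s'' + M' a' b' r s - M' a b r' s'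
            + (n - 2 * p) * (J a' b' r s + J a b r' s'))"
  unfolding M_def M'_def J_def D1_def D2_def by algebra

text \<open>The value of the operator at \<open>x\<close> in terms of the values \<open>A\<close>, \<open>A'\<close>, \<open>A''\<close> of the function and its
  derivatives, with \<open>c\<close> in place of \<open>- N (N + n + 2)\<close>; the two constant matrices of order zero are
  merged into one.\<close>

definition D_tilde_jet ::
    "real \<Rightarrow> real \<Rightarrow> real \<Rightarrow> real \<Rightarrow> real^2^2 \<Rightarrow> real^2^2 \<Rightarrow> real^2^2 \<Rightarrow> real \<Rightarrow> real^2^2" where
  "D_tilde_jet p n \<alpha> c A A' A'' x = ((x\<^sup>2 - 1) * (x - \<alpha>)) *\<^sub>R A''
     + ((n + 3) * x\<^sup>2 - \<alpha> * (n + 2) * x - 1) *\<^sub>R A' + (2 * (x - \<alpha>)) *\<^sub>R (A' ** mat2 0 1 1 0)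
     + (c * x) *\<^sub>R A + A ** mat2 (\<alpha> * (n - 2 * p)) (n - p + 1) (p + 1) 0"

lemma mat2_mult_mat: "A ** mat c = c *\<^sub>R A" for A :: "real^2^2"
  by (simp add: vec_eq_iff matrix_matrix_mult_def sum_2 forall_2 mat_def)

lemma D_tilde_eq:
  assumes "\<And>x. (P has_vector_derivative P' x) (at x)"
    and "\<And>x. (P' has_vector_derivative P'' x) (at x)"
  shows "D_tilde p n \<alpha> N P x = D_tilde_jet p n \<alpha> (- real N * (real N + n + 2)) (P x) (P' x) (P'' x) x"
proof -
  have "(\<lambda>s. vector_derivative P (at s)) = P'"
    using assms(1) by (intro ext vector_derivative_at)
  then have "vector_derivative P (at x) = P' x"
    and "vector_derivative (\<lambda>s. vector_derivative P (at s)) (at x) = P'' x"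
    using assms(1)[of x, THEN vector_derivative_at] assms(2)[of x, THEN vector_derivative_at] by simp_all
  moreover have "e *\<^sub>R (A ** mat2 1 0 0 0) + A ** mat2 0 f g 0 = A ** mat2 e f g 0" for A e f g
    by (simp add: mat2_entry algebra_simps)
  ultimately show ?thesis
    by (simp add: D_tilde_def right_diff_op_def D_tilde_jet_def mat2_mult_mat matrix_add_ldistrib
        mat2_mult_scaleR)
qed

text \<open>
  The concomitant \<open>G\<close> is found by integrating by parts. The leading coefficient of the operator
  times the weight is \<open>- (x - \<alpha>) (1 - x\<^sup>2)\<^bsup>n/2\<^esup>\<close> times the polynomial part \<open>M\<close>, which accounts for the
  terms with \<open>P'\<close> and \<open>Q'\<close>. What remains is \<open>P E Q\<^sup>*\<close>, where \<open>E\<close> is the skew part of \<open>F\<^sub>1 W\<close>; it too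
  contains the factor \<open>(1 - x\<^sup>2)\<^bsup>n/2\<^esup>\<close>, because \<open>M\<^sub>2\<^sub>2 - M\<^sub>1\<^sub>1 = - (n - 2 p) (1 - x\<^sup>2)\<close>.
\<close>

lemma Lagrange_identity:
  fixes n p \<alpha> :: real
  assumes P: "\<And>x. (P has_vector_derivative P' x) (at x)" "\<And>x. (P' has_vector_derivative P'' x) (at x)"
    and Q: "\<And>x. (Q has_vector_derivative Q' x) (at x)" "\<And>x. (Q' has_vector_derivative Q'' x) (at x)"
    and x: "x \<in> {-1<..<1}"
  defines "G \<equiv> \<lambda>x. (- ((1 - x\<^sup>2) powr (n / 2) * (x - \<alpha>))) *\<^sub>R
      (P' x ** polyweight p n x ** transpose (Q x) - P x ** polyweight p n x ** transpose (Q' x)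
        + (n - 2 * p) *\<^sub>R (P x ** mat2 0 1 (- 1) 0 ** transpose (Q x)))"
  shows "(G has_vector_derivative
      D_tilde p n \<alpha> N P x ** weight p n x ** transpose (Q x)
      - P x ** weight p n x ** transpose (D_tilde p n \<alpha> N Q x)) (at x)"
proof -
  note mult = bounded_bilinear.has_vector_derivative[OF bounded_bilinear_mat2_mult]
  note tr = bounded_linear.has_vector_derivative[OF bounded_linear_transpose]
  define \<omega> where "\<omega> = (1 - x\<^sup>2) powr (n / 2 - 1)"
  have pos: "1 - x\<^sup>2 > 0" using x by (simp add: abs_square_less_1 abs_less_iff)
  have \<omega>: "(1 - x\<^sup>2) powr (n / 2) = (1 - x\<^sup>2) * \<omega>"
    using pos by (simp add: \<omega>_def powr_diff)
  have \<phi>: "((\<lambda>x. - ((1 - x\<^sup>2) powr (n / 2) * (x - \<alpha>))) has_real_derivative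
      (n * x * (x - \<alpha>) - (1 - x\<^sup>2)) * \<omega>) (at x)"
  proof -
    have "((\<lambda>x. - ((1 - x\<^sup>2) powr (n / 2) * (x - \<alpha>))) has_real_derivative
        - ((n / 2) * \<omega> * (- (2 * x)) * (x - \<alpha>) + (1 - x\<^sup>2) powr (n / 2))) (at x)"
      unfolding \<omega>_def using pos by (auto intro!: derivative_eq_intros)
    then show ?thesis unfolding \<omega> by (simp add: algebra_simps)
  qed
  define c where "c = - real N * (real N + n + 2)"
  let ?M = "polyweight p n x" and ?M' = "mat2 (2 * p * x) (- n) (- n) (2 * (n - p) * x)"
    and ?J = "mat2 0 1 (- 1) 0"
  define B where "B = P' x ** ?M ** transpose (Q x) - P x ** ?M ** transpose (Q' x)
    + (n - 2 * p) *\<^sub>R (P x ** ?J ** transpose (Q x))"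
  define B' where "B' = P'' x ** ?M ** transpose (Q x) - P x ** ?M ** transpose (Q'' x)
    + P' x ** ?M' ** transpose (Q x) - P x ** ?M' ** transpose (Q' x)
    + (n - 2 * p) *\<^sub>R (P' x ** ?J ** transpose (Q x) + P x ** ?J ** transpose (Q' x))"
  have "((\<lambda>x. P' x ** polyweight p n x ** transpose (Q x) - P x ** polyweight p n x ** transpose (Q' x)
        + (n - 2 * p) *\<^sub>R (P x ** mat2 0 1 (- 1) 0 ** transpose (Q x))) has_vector_derivative B') (at x)"
    unfolding B'_def
    by (rule derivative_eq_intros mult tr P Q polyweight_deriv refl
        | simp add: vec_eq_iff mat2_mult_entry algebra_simps)+
  from has_vector_derivative_scaleR[OF \<phi> this]
  have "(G has_vector_derivative (- ((1 - x\<^sup>2) powr (n / 2) * (x - \<alpha>))) *\<^sub>R B'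
      + ((n * x * (x - \<alpha>) - (1 - x\<^sup>2)) * \<omega>) *\<^sub>R B) (at x)"
    by (simp add: G_def B_def)
  moreover have "(- ((1 - x\<^sup>2) powr (n / 2) * (x - \<alpha>))) *\<^sub>R B'
      + ((n * x * (x - \<alpha>) - (1 - x\<^sup>2)) * \<omega>) *\<^sub>R B
    = \<omega> *\<^sub>R (((n * x * (x - \<alpha>) - (1 - x\<^sup>2))) *\<^sub>R B - ((1 - x\<^sup>2) * (x - \<alpha>)) *\<^sub>R B')"
    by (simp add: \<omega> algebra_simps)
  moreover have "((n * x * (x - \<alpha>) - (1 - x\<^sup>2))) *\<^sub>R B - ((1 - x\<^sup>2) * (x - \<alpha>)) *\<^sub>R B'
    = D_tilde p n \<alpha> N P x ** ?M ** transpose (Q x) - P x ** ?M ** transpose (D_tilde p n \<alpha> N Q x)"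
  proof (unfold vec_eq_iff, intro allI)
    fix i j
    have M: "(A ** polyweight p n x ** transpose C) $ i $ j =
       p * (x * A $ i $ 1 - A $ i $ 2) * (x * C $ j $ 1 - C $ j $ 2)
       + (n - p) * (A $ i $ 1 - x * A $ i $ 2) * (C $ j $ 1 - x * C $ j $ 2)" for A C :: "real^2^2"
      by (simp add: mat2_mult_entry polyweight_def mat2_nth transpose_def power2_eq_square algebra_simps)
    have M': "(A ** ?M' ** transpose C) $ i $ j =
       2 * p * x * A $ i $ 1 * C $ j $ 1 - n * (A $ i $ 1 * C $ j $ 2 + A $ i $ 2 * C $ j $ 1)
       + 2 * (n - p) * x * A $ i $ 2 * C $ j $ 2" for A C :: "real^2^2"
      by (simp add: mat2_mult_entry mat2_nth transpose_def algebra_simps)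
    have J: "(A ** ?J ** transpose C) $ i $ j = A $ i $ 1 * C $ j $ 2 - A $ i $ 2 * C $ j $ 1" for A C :: "real^2^2"
      by (simp add: mat2_mult_entry mat2_nth transpose_def algebra_simps)
    have D: "D_tilde_jet p n \<alpha> c A A' A'' x $ k $ 1 = (x\<^sup>2 - 1) * (x - \<alpha>) * A'' $ k $ 1
            + (((n + 3) * x\<^sup>2 - \<alpha> * (n + 2) * x - 1) * A' $ k $ 1 + 2 * (x - \<alpha>) * A' $ k $ 2)
            + (c * x + \<alpha> * (n - 2 * p)) * A $ k $ 1 + (p + 1) * A $ k $ 2"
      "D_tilde_jet p n \<alpha> c A A' A'' x $ k $ 2 = (x\<^sup>2 - 1) * (x - \<alpha>) * A'' $ k $ 2
            + (((n + 3) * x\<^sup>2 - \<alpha> * (n + 2) * x - 1) * A' $ k $ 2 + 2 * (x - \<alpha>) * A' $ k $ 1)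
            + c * x * A $ k $ 2 + (n - p + 1) * A $ k $ 1" for A A' A'' :: "real^2^2" and k
      by (simp_all add: D_tilde_jet_def mat2_mult_entry mat2_nth algebra_simps)
    show "(((n * x * (x - \<alpha>) - (1 - x\<^sup>2))) *\<^sub>R B - ((1 - x\<^sup>2) * (x - \<alpha>)) *\<^sub>R B') $ i $ j
      = (D_tilde p n \<alpha> N P x ** ?M ** transpose (Q x)
          - P x ** ?M ** transpose (D_tilde p n \<alpha> N Q x)) $ i $ j"
      unfolding D_tilde_eq[OF P] D_tilde_eq[OF Q] c_def[symmetric] B_def B'_def vector_minus_component
        vector_add_component vector_scaleR_component M M' J D Lagrange_identity_rows real_scaleR_def ..
  qed
  ultimately show ?thesis
    by (simp add: weight_eq \<omega>_def mat2_mult_scaleR scaleR_diff_right transpose_scalar)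
qed

lemma continuous_on_of_has_vector_derivative:
  assumes "\<And>x. (f has_vector_derivative f' x) (at x)"
  shows "continuous_on S f"
  using assms has_vector_derivative_continuous by (metis continuous_at_imp_continuous_on)

lemma D_tilde_continuous:
  assumes P: "\<And>x. (P has_vector_derivative P' x) (at x)" "\<And>x. (P' has_vector_derivative P'' x) (at x)"
    and "continuous_on UNIV P''"
  shows "continuous_on S (D_tilde p n \<alpha> N P)"
proof -
  have c: "continuous_on S P" "continuous_on S P'" "continuous_on S P''"
    using P assms(3) by (blast intro: continuous_on_of_has_vector_derivative continuous_on_subset)+
  show ?thesis
    unfolding D_tilde_eq[OF P] D_tilde_jet_def
    by (intro continuous_intros c bounded_bilinear.continuous_on[OF bounded_bilinear_mat2_mult])
qed

text \<open>The concomitant vanishes at both end points because \<open>n / 2 > 0\<close>. The weight may be unbounded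
  there, so the fundamental theorem of calculus is used in the form that asks for derivatives only
  in the open interval.\<close>

lemma D_tilde_symmetric:
  assumes n: "n > 0"
    and P: "\<And>x. (P has_vector_derivative P' x) (at x)" "\<And>x. (P' has_vector_derivative P'' x) (at x)"
    and Q: "\<And>x. (Q has_vector_derivative Q' x) (at x)" "\<And>x. (Q' has_vector_derivative Q'' x) (at x)"
    and cont: "continuous_on UNIV P''" "continuous_on UNIV Q''"
  shows "matrix_inner (weight p n) (D_tilde p n \<alpha> N P) Q = matrix_inner (weight p n) P (D_tilde p n \<alpha> N Q)"
proof -
  let ?D = "D_tilde p n \<alpha> N"
  let ?G = "\<lambda>x. (- ((1 - x\<^sup>2) powr (n / 2) * (x - \<alpha>))) *\<^sub>R
      (P' x ** polyweight p n x ** transpose (Q x) - P x ** polyweight p n x ** transpose (Q' x)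
        + (n - 2 * p) *\<^sub>R (P x ** mat2 0 1 (- 1) 0 ** transpose (Q x)))"
  have c: "continuous_on {-1..1} P" "continuous_on {-1..1} P'" "continuous_on {-1..1} Q" "continuous_on {-1..1} Q'"
    using P Q by (blast intro: continuous_on_of_has_vector_derivative)+
  have nonneg: "0 \<le> 1 - x\<^sup>2" if "x \<in> {-1..1}" for x :: real
    using that by (simp add: abs_square_le_1 abs_le_iff)
  have "continuous_on {-1..1} ?G"
    using n nonneg by (intro continuous_intros c polyweight_continuous continuous_on_powr'
        bounded_bilinear.continuous_on[OF bounded_bilinear_mat2_mult]
        bounded_linear.continuous_on[OF bounded_linear_transpose]) auto
  then have "((\<lambda>x. ?D P x ** weight p n x ** transpose (Q x) - P x ** weight p n x ** transpose (?D Q x))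
      has_integral (?G 1 - ?G (- 1))) {-1..1}"
    using Lagrange_identity[OF P Q] by (intro fundamental_theorem_of_calculus_interior) auto
  then have "integral {-1..1} (\<lambda>x. ?D P x ** weight p n x ** transpose (Q x) - P x ** weight p n x ** transpose (?D Q x)) = 0"
    by (simp add: integral_unique)
  moreover have "continuous_on {-1..1} (?D P)" "continuous_on {-1..1} (?D Q)"
    using D_tilde_continuous P Q cont by blast+
  ultimately show ?thesis
    using c n by (simp add: matrix_inner_def integral_diff matrix_inner_integrable)
qed

section \<open>Matrix polynomials of bounded degree\<close>

definition matrix_polys :: "nat \<Rightarrow> (real \<Rightarrow> real^2^2) set" where
  "matrix_polys N = {P. \<exists>c. \<forall>x. P x = (\<Sum>i\<le>N. x ^ i *\<^sub>R c i)}"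

lemma matrix_polys_monomial: "i \<le> N \<Longrightarrow> (\<lambda>x. x ^ i *\<^sub>R A) \<in> matrix_polys N"
  unfolding matrix_polys_def
  by (rule CollectI, rule exI[of _ "\<lambda>j. if j = i then A else 0"]) (auto simp: if_distrib cong: if_cong)

lemma matrix_polys_add:
  assumes "P \<in> matrix_polys N" "Q \<in> matrix_polys N" shows "(\<lambda>x. P x + Q x) \<in> matrix_polys N"
proof -
  obtain c d where "\<And>x. P x = (\<Sum>i\<le>N. x ^ i *\<^sub>R c i)" "\<And>x. Q x = (\<Sum>i\<le>N. x ^ i *\<^sub>R d i)"
    using assms by (auto simp: matrix_polys_def)
  then show ?thesis unfolding matrix_polys_def
    by (intro CollectI exI[of _ "\<lambda>i. c i + d i"]) (simp add: scaleR_add_right sum.distrib)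
qed

lemma matrix_polys_mult:
  assumes "P \<in> matrix_polys N" shows "(\<lambda>x. A ** P x) \<in> matrix_polys N"
proof -
  obtain c where "\<And>x. P x = (\<Sum>i\<le>N. x ^ i *\<^sub>R c i)"
    using assms by (auto simp: matrix_polys_def)
  then show ?thesis unfolding matrix_polys_def
    by (intro CollectI exI[of _ "\<lambda>i. A ** c i"])
       (simp add: bounded_bilinear.sum_right[OF bounded_bilinear_mat2_mult] mat2_mult_scaleR)
qed

lemma matrix_polys_sum:
  "finite I \<Longrightarrow> (\<And>i. i \<in> I \<Longrightarrow> P i \<in> matrix_polys N) \<Longrightarrow> (\<lambda>x. \<Sum>i\<in>I. P i x) \<in> matrix_polys N"
proof (induction I rule: finite_induct)
  case empty
  show ?case using matrix_polys_monomial[of 0 N 0] by simp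
qed (auto intro: matrix_polys_add)

lemma matrix_polys_mono:
  assumes "P \<in> matrix_polys M" "M \<le> N" shows "P \<in> matrix_polys N"
proof -
  obtain c where "\<And>x. P x = (\<Sum>i\<le>M. x ^ i *\<^sub>R c i)"
    using assms by (auto simp: matrix_polys_def)
  then have "P = (\<lambda>x. \<Sum>i\<le>M. x ^ i *\<^sub>R c i)" by auto
  then show ?thesis using assms(2) by (auto intro!: matrix_polys_sum matrix_polys_monomial)
qed

lemma matrix_polys_derivs:
  assumes "P \<in> matrix_polys N"
  obtains P' P'' where "\<And>x. (P has_vector_derivative P' x) (at x)"
    "\<And>x. (P' has_vector_derivative P'' x) (at x)" "continuous_on UNIV P''"
proof -
  obtain c where c: "\<And>x. P x = (\<Sum>i\<le>N. x ^ i *\<^sub>R c i)"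
    using assms by (auto simp: matrix_polys_def)
  then have P: "P = (\<lambda>x. \<Sum>i\<le>N. x ^ i *\<^sub>R c i)" by auto
  have pow: "((\<lambda>x. x ^ k *\<^sub>R A) has_vector_derivative (real k * x ^ (k - 1)) *\<^sub>R A) (at x)"
    for A :: "real^2^2" and k x
    by (rule derivative_eq_intros refl | simp)+
  show ?thesis
  proof
    show "(P has_vector_derivative (\<Sum>i\<le>N. x ^ (i - 1) *\<^sub>R (real i *\<^sub>R c i))) (at x)" for x
      unfolding P using pow by (auto intro!: has_vector_derivative_sum simp: mult.commute)
    show "((\<lambda>x. \<Sum>i\<le>N. x ^ (i - 1) *\<^sub>R (real i *\<^sub>R c i)) has_vector_derivative
        (\<Sum>i\<le>N. (real (i - 1) * x ^ (i - 1 - 1)) *\<^sub>R (real i *\<^sub>R c i))) (at x)" for x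
      using pow by (intro has_vector_derivative_sum) blast
    show "continuous_on UNIV (\<lambda>x. \<Sum>i\<le>N. (real (i - 1) * x ^ (i - 1 - 1)) *\<^sub>R (real i *\<^sub>R c i))"
      by (intro continuous_intros)
  qed
qed

lemma matrix_polys_continuous: "P \<in> matrix_polys N \<Longrightarrow> continuous_on S P"
  by (metis matrix_polys_derivs continuous_on_of_has_vector_derivative)

text \<open>The operator acts from the right, so it commutes with constant factors on the left.\<close>

lemma D_tilde_sum_mult:
  assumes "finite I" "\<And>i. i \<in> I \<Longrightarrow> P i \<in> matrix_polys M"
  shows "D_tilde p n \<alpha> N (\<lambda>x. \<Sum>i\<in>I. A i ** P i x) x = (\<Sum>i\<in>I. A i ** D_tilde p n \<alpha> N (P i) x)"
proof -
  have "\<forall>i\<in>I. \<exists>P' P''. (\<forall>x. (P i has_vector_derivative P' x) (at x)) \<and>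
      (\<forall>x. (P' has_vector_derivative P'' x) (at x))"
    using matrix_polys_derivs assms(2) by metis
  then obtain P' P'' where P: "\<And>i x. i \<in> I \<Longrightarrow> (P i has_vector_derivative P' i x) (at x)"
      "\<And>i x. i \<in> I \<Longrightarrow> (P' i has_vector_derivative P'' i x) (at x)"
    by metis
  have left: "((\<lambda>x. A ** F x) has_vector_derivative A ** F') (at x)"
    if "(F has_vector_derivative F') (at x)" for A :: "real^2^2" and F :: "real \<Rightarrow> real^2^2" and F' x
    using bounded_linear.has_vector_derivative[OF bounded_bilinear.bounded_linear_right[OF bounded_bilinear_mat2_mult] that] .
  have "((\<lambda>x. \<Sum>i\<in>I. A i ** P i x) has_vector_derivative (\<Sum>i\<in>I. A i ** P' i x)) (at x)"
    and "((\<lambda>x. \<Sum>i\<in>I. A i ** P' i x) has_vector_derivative (\<Sum>i\<in>I. A i ** P'' i x)) (at x)" for x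
    using P by (auto intro!: has_vector_derivative_sum left)
  from D_tilde_eq[OF this]
  show ?thesis using D_tilde_eq[OF P]
    by (simp add: D_tilde_jet_def matrix_add_ldistrib sum.distrib mat2_mult_scaleR scaleR_sum_right
        matrix_mul_assoc bounded_bilinear.sum_left[OF bounded_bilinear_mat2_mult]
        bounded_bilinear.diff_right[OF bounded_bilinear_mat2_mult] sum_subtractf sum_negf)
qed

text \<open>The parts \<open>x\<^sup>3\<close>, \<open>(n + 3) x\<^sup>2\<close> and \<open>- N (N + n + 2) x\<close> of the three coefficients raise the degree by
  one. On \<open>x\<^sup>i\<close> they contribute \<open>i (i - 1) + (n + 3) i - N (N + n + 2)\<close>, which is the number \<open>e\<close> of the
  proof and is zero for \<open>i = N\<close>; for \<open>i < N\<close> there is room for one more degree.\<close>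

lemma D_tilde_monomial_matrix_polys:
  assumes "i \<le> N"
  shows "D_tilde p n \<alpha> N (\<lambda>x. x ^ i *\<^sub>R mat 1) \<in> matrix_polys N"
proof -
  define c where "c = - real N * (real N + n + 2)"
  define \<sigma> :: "real^2^2" where "\<sigma> = mat2 0 1 1 0"
  define C where "C = mat2 (\<alpha> * (n - 2 * p)) (n - p + 1) (p + 1) 0"
  have D: "D_tilde p n \<alpha> N (\<lambda>x. x ^ i *\<^sub>R mat 1) =
    (\<lambda>x. D_tilde_jet p n \<alpha> c (x ^ i *\<^sub>R mat 1) ((real i * x ^ (i - 1)) *\<^sub>R mat 1)
       ((real i * (real (i - 1) * x ^ (i - 1 - 1))) *\<^sub>R mat 1) x)"
    unfolding c_def
    by (intro ext D_tilde_eq) (rule derivative_eq_intros refl | simp)+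
  define e where "e = real i * (real i + n + 2) + c"
  have e: "e = 0" if "i = N" using that by (simp add: e_def c_def)
  have "D_tilde p n \<alpha> N (\<lambda>x. x ^ i *\<^sub>R mat 1) =
    (\<lambda>x. x ^ (i + 1) *\<^sub>R mat e
       + x ^ i *\<^sub>R (mat (- \<alpha> * real i * (real i + n + 1)) + (2 * real i) *\<^sub>R \<sigma> + C)
       + x ^ (i - 1) *\<^sub>R (mat (- real i * (real i)) - (2 * \<alpha> * real i) *\<^sub>R \<sigma>)
       + x ^ (i - 2) *\<^sub>R mat (\<alpha> * real i * (real i - 1)))"
  proof
    fix x
    \<comment> \<open>For \<open>i < 2\<close> the exponents \<open>i - 1\<close> and \<open>i - 2\<close> are truncated, but the coefficients of the
      monomials concerned are zero.\<close>
    consider "i = 0" | "i = 1" | k where "i = Suc (Suc k)"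
      by (metis One_nat_def not0_implies_Suc)
    then show "D_tilde p n \<alpha> N (\<lambda>x. x ^ i *\<^sub>R mat 1) x =
        x ^ (i + 1) *\<^sub>R mat e
       + x ^ i *\<^sub>R (mat (- \<alpha> * real i * (real i + n + 1)) + (2 * real i) *\<^sub>R \<sigma> + C)
       + x ^ (i - 1) *\<^sub>R (mat (- real i * (real i)) - (2 * \<alpha> * real i) *\<^sub>R \<sigma>)
       + x ^ (i - 2) *\<^sub>R mat (\<alpha> * real i * (real i - 1))"
      unfolding D
      by cases (simp_all add: D_tilde_jet_def e_def \<sigma>_def C_def mat2_entry power2_eq_square algebra_simps)
  qed
  moreover have "(\<lambda>x. x ^ (i + 1) *\<^sub>R mat e) \<in> matrix_polys N"
  proof (cases "i = N")
    case True
    then show ?thesis using e matrix_polys_monomial[of 0 N 0] by (simp add: mat_0)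
  next
    case False
    then show ?thesis using assms by (intro matrix_polys_monomial) auto
  qed
  ultimately show ?thesis
    using assms by (auto intro!: matrix_polys_add matrix_polys_monomial)
qed

lemma D_tilde_matrix_polys:
  assumes "P \<in> matrix_polys N"
  shows "D_tilde p n \<alpha> N P \<in> matrix_polys N"
proof -
  obtain c where "\<And>x. P x = (\<Sum>i\<le>N. x ^ i *\<^sub>R c i)"
    using assms by (auto simp: matrix_polys_def)
  then have P: "P = (\<lambda>x. \<Sum>i\<le>N. c i ** (x ^ i *\<^sub>R mat 1))"
    by (simp add: mat2_mult_scaleR mat2_mult_mat fun_eq_iff)
  have "D_tilde p n \<alpha> N P = (\<lambda>x. \<Sum>i\<le>N. c i ** D_tilde p n \<alpha> N (\<lambda>x. x ^ i *\<^sub>R mat 1) x)"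
    unfolding P by (intro ext D_tilde_sum_mult[of _ _ N] matrix_polys_monomial) auto
  then show ?thesis
    by (auto intro!: matrix_polys_sum matrix_polys_mult D_tilde_monomial_matrix_polys)
qed

section \<open>The matrix-valued inner product\<close>

lemma matrix_inner_transpose:
  fixes P Q :: "real \<Rightarrow> real^2^2"
  assumes "n > 0" "continuous_on {-1..1} P" "continuous_on {-1..1} Q"
  shows "transpose (matrix_inner (weight p n) P Q) = matrix_inner (weight p n) Q P"
proof -
  have "transpose (weight p n x) = weight p n x" for x
    by (simp add: weight_eq transpose_scalar polyweight_def mat2_entry)
  then show ?thesis
    using integral_linear[OF matrix_inner_integrable[OF assms, of p] bounded_linear_transpose]
    by (simp add: matrix_inner_def o_def matrix_transpose_mul matrix_mul_assoc)
qed

lemma matrix_inner_mult_left: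
  fixes P Q :: "real \<Rightarrow> real^2^2"
  assumes "n > 0" "continuous_on {-1..1} P" "continuous_on {-1..1} Q"
  shows "matrix_inner (weight p n) (\<lambda>x. A ** P x) Q = A ** matrix_inner (weight p n) P Q"
  using integral_linear[OF matrix_inner_integrable[OF assms]
      bounded_bilinear.bounded_linear_right[OF bounded_bilinear_mat2_mult, of A]]
  by (simp add: matrix_inner_def o_def matrix_mul_assoc)

lemma matrix_inner_mult_right:
  fixes P Q :: "real \<Rightarrow> real^2^2"
  assumes "n > 0" "continuous_on {-1..1} P" "continuous_on {-1..1} Q"
  shows "matrix_inner (weight p n) P (\<lambda>x. A ** Q x) = matrix_inner (weight p n) P Q ** transpose A"
  using integral_linear[OF matrix_inner_integrable[OF assms]
      bounded_bilinear.bounded_linear_left[OF bounded_bilinear_mat2_mult, of "transpose A"]]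
  by (simp add: matrix_inner_def o_def matrix_mul_assoc matrix_transpose_mul)

lemma matrix_inner_sum_left:
  fixes P :: "'i \<Rightarrow> real \<Rightarrow> real^2^2" and Q :: "real \<Rightarrow> real^2^2"
  assumes "n > 0" "finite I" "\<And>i. i \<in> I \<Longrightarrow> continuous_on {-1..1} (P i)" "continuous_on {-1..1} Q"
  shows "matrix_inner (weight p n) (\<lambda>x. \<Sum>i\<in>I. P i x) Q = (\<Sum>i\<in>I. matrix_inner (weight p n) (P i) Q)"
  unfolding matrix_inner_def bounded_bilinear.sum_left[OF bounded_bilinear_mat2_mult]
  using assms by (intro integral_sum matrix_inner_integrable)

text \<open>This form of the weight shows that it is positive definite for \<open>0 < p < n\<close> and \<open>x\<^sup>2 \<noteq> 1\<close>: the
  quantities \<open>x a - b\<close> and \<open>a - x b\<close> vanish together only for \<open>a = b = 0\<close>.\<close>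

lemma polyweight_quadratic_form:
  fixes A :: "real^2^2"
  shows "v \<bullet> ((A ** polyweight p n x ** transpose A) *v v)
    = p * (x * (v v* A) $ 1 - (v v* A) $ 2)\<^sup>2 + (n - p) * ((v v* A) $ 1 - x * (v v* A) $ 2)\<^sup>2"
  by (simp add: inner_vec_def matrix_vector_mult_def vector_matrix_mult_def mat2_mult_entry sum_2
      polyweight_def mat2_nth transpose_def power2_eq_square algebra_simps)

lemma monic_matrix_poly_in: "monic_matrix_poly w P \<Longrightarrow> P \<in> matrix_polys w"
  by (auto simp: monic_matrix_poly_def matrix_polys_def)

text \<open>A polynomial with infinitely many zeros is zero, and the leading coefficient of the row \<open>v P\<close> is
  \<open>v\<close> itself.\<close>

lemma monic_matrix_poly_rows_independent:
  assumes P: "monic_matrix_poly w P" and S: "infinite S" and v: "\<And>x. x \<in> S \<Longrightarrow> v v* P x = 0"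
  shows "v = 0"
proof -
  obtain c where c: "c w = mat 1" "\<And>x. P x = (\<Sum>i\<le>w. x ^ i *\<^sub>R c i)"
    using P by (auto simp: monic_matrix_poly_def)
  have "v $ k = 0" for k
  proof -
    have "(v v* P x) $ k = (\<Sum>i\<le>w. (v v* c i) $ k * x ^ i)" for x
      by (simp add: c vector_matrix_mult_def sum_2 sum_distrib_left sum.distrib[symmetric] algebra_simps)
    then have "(\<Sum>i\<le>w. (v v* c i) $ k * x ^ i) = 0" if "x \<in> S" for x
      using v[OF that] by (metis zero_index)
    then have "S \<subseteq> {x. (\<Sum>i\<le>w. (v v* c i) $ k * x ^ i) = 0}" by blast
    then have "\<not> finite {x. (\<Sum>i\<le>w. (v v* c i) $ k * x ^ i) = 0}" using S finite_subset by blast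
    then have "(v v* c w) $ k = 0"
      using polyfun_finite_roots[of "\<lambda>i. (v v* c i) $ k" w] by auto
    then show ?thesis by (simp add: c)
  qed
  then show ?thesis by (simp add: vec_eq_iff)
qed

text \<open>The number \<open>v \<bullet> \<langle>P, P\<rangle> v\<close> is the integral of the nonnegative quadratic form of the weight in the row
  \<open>v P\<close>. If it were zero, that row would vanish on an interval, hence \<open>v = 0\<close>. The interval
  \<open>[-1/2, 1/2]\<close> keeps away from the end points, where the weight need not be continuous.\<close>

lemma matrix_inner_monic_pos_def:
  assumes p: "0 < p" "p < n" and P: "monic_matrix_poly w P"
  shows "pos_def (matrix_inner (weight p n) P P)"
  unfolding pos_def_def
proof (intro conjI allI impI)
  have n: "n > 0" using p by simp
  have c: "continuous_on {-1..1} P"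
    using matrix_polys_continuous monic_matrix_poly_in[OF P] by blast
  show "transpose (matrix_inner (weight p n) P P) = matrix_inner (weight p n) P P"
    by (rule matrix_inner_transpose[OF n c c])
  fix v :: "real^2" assume "v \<noteq> 0"
  let ?L = "\<lambda>A :: real^2^2. v \<bullet> (A *v v)"
  have L: "bounded_linear ?L"
    by (rule iffD1[OF linear_conv_bounded_linear])
       (auto simp: linear_iff inner_vec_def matrix_vector_mult_def sum_2 algebra_simps)
  define q where "q x = p * (x * (v v* P x) $ 1 - (v v* P x) $ 2)\<^sup>2
    + (n - p) * ((v v* P x) $ 1 - x * (v v* P x) $ 2)\<^sup>2" for x
  define g where "g x = (1 - x\<^sup>2) powr (n / 2 - 1) * q x" for x
  have q: "?L (P x ** polyweight p n x ** transpose (P x)) = q x" for x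
    by (simp add: q_def polyweight_quadratic_form)
  have g: "?L (P x ** weight p n x ** transpose (P x)) = g x" for x
    unfolding g_def q[symmetric]
    by (simp add: weight_eq mat2_mult_scaleR scaleR_matrix_vector_assoc[symmetric])
  have g0: "g x \<ge> 0" for x using p by (simp add: g_def q_def)
  have int: "g integrable_on {-1..1}"
    and inner: "?L (matrix_inner (weight p n) P P) = integral {-1..1} g"
    using integrable_linear[OF matrix_inner_integrable[OF n c c, of p] L]
      integral_linear[OF matrix_inner_integrable[OF n c c, of p] L]
    by (simp_all add: o_def g matrix_inner_def)
  have "integral {-1..1} g \<noteq> 0"
  proof
    assume "integral {-1..1} g = 0"
    have sub: "{-1/2..1/2} \<subseteq> {-1..1::real}" by auto
    then have int': "g integrable_on {-1/2..1/2}" using int by (rule integrable_on_subinterval[rotated])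
    then have "integral {-1/2..1/2} g \<le> integral {-1..1} g"
      using sub int g0 by (intro integral_subset_le) auto
    moreover have "integral {-1/2..1/2} g \<ge> 0" using int' g0 by (intro integral_nonneg) auto
    ultimately have zero: "integral {-1/2..1/2} g = 0" using \<open>integral {-1..1} g = 0\<close> by simp
    have sq: "1 - x\<^sup>2 > 0" if "x \<in> {-1/2..1/2}" for x :: real
      using that by (simp add: abs_square_less_1 abs_less_iff)
    have c': "continuous_on {-1/2..1/2} P" using c sub by (rule continuous_on_subset)
    have "continuous_on {-1/2..1/2} (\<lambda>x. (1 - x\<^sup>2) powr (n / 2 - 1) * ?L (P x ** polyweight p n x ** transpose (P x)))"
      using sq by (intro continuous_intros bounded_linear.continuous_on[OF L] c' polyweight_continuous
        bounded_bilinear.continuous_on[OF bounded_bilinear_mat2_mult]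
        bounded_linear.continuous_on[OF bounded_linear_transpose]) force
    then have "continuous_on {-1/2..1/2} g" by (simp add: g_def[abs_def] q)
    then have "\<forall>x\<in>{-1/2..1/2}. g x = 0"
      using integral_eq_0_iff[of "-1/2" "1/2" g] zero g0 by simp
    have "v v* P x = 0" if "x \<in> {-1/2..1/2}" for x
    proof -
      have "g x = 0" using \<open>\<forall>x\<in>{-1/2..1/2}. g x = 0\<close> that by (rule bspec)
      then have "q x = 0" using sq[OF that] by (auto simp: g_def)
      moreover have "a = 0" "b = 0" if "p * a\<^sup>2 + (n - p) * b\<^sup>2 = 0" for a b
        using that p by (simp_all add: add_nonneg_eq_0_iff)
      ultimately have "x * (v v* P x) $ 1 - (v v* P x) $ 2 = 0" "(v v* P x) $ 1 - x * (v v* P x) $ 2 = 0"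
        unfolding q_def by blast+
      then have e: "x * (v v* P x) $ 1 = (v v* P x) $ 2" "(v v* P x) $ 1 = x * (v v* P x) $ 2"
        by linarith+
      have "(1 - x\<^sup>2) * (v v* P x) $ 1 = (v v* P x) $ 1 - x * (x * (v v* P x) $ 1)"
        by (simp add: power2_eq_square left_diff_distrib)
      also have "\<dots> = 0" unfolding e(1) using e(2) by linarith
      finally have "(v v* P x) $ 1 = 0" using sq[OF that] by simp
      with e(1) show ?thesis by (simp add: vec_eq_iff forall_2)
    qed
    then have "v = 0"
      using monic_matrix_poly_rows_independent[OF P, of "{-1/2..1/2}" v] by (simp add: infinite_Icc)
    with \<open>v \<noteq> 0\<close> show False by simp
  qed
  moreover have "integral {-1..1} g \<ge> 0" using int g0 by (intro integral_nonneg) auto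
  ultimately show "?L (matrix_inner (weight p n) P P) > 0" unfolding inner by simp
qed

section \<open>The kernel\<close>

text \<open>As \<open>R\<^sub>N\<close> is monic, subtracting the leading coefficient of \<open>P\<close> times \<open>R\<^sub>N\<close> lowers the degree.\<close>

lemma matrix_polys_expansion:
  assumes Q: "\<And>w. w \<le> N \<Longrightarrow> monic_matrix_poly w (R w)"
    and P: "P \<in> matrix_polys N"
  shows "\<exists>A. \<forall>x. P x = (\<Sum>w\<le>N. A w ** R w x)"
  using assms
proof (induction N arbitrary: P)
  case 0
  obtain c where "\<And>x. P x = c (0::nat)" using 0(2) by (auto simp: matrix_polys_def)
  moreover have "R 0 x = mat 1" for x using 0(1)[of 0] by (auto simp: monic_matrix_poly_def)
  ultimately show ?case by (intro exI[of _ c]) simp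
next
  case (Suc N)
  obtain c where c: "\<And>x. P x = (\<Sum>i\<le>Suc N. x ^ i *\<^sub>R c i)" using Suc.prems(2) by (auto simp: matrix_polys_def)
  obtain d where d: "d (Suc N) = mat 1" "\<And>x. R (Suc N) x = (\<Sum>i\<le>Suc N. x ^ i *\<^sub>R d i)"
    using Suc.prems(1)[of "Suc N"] by (auto simp: monic_matrix_poly_def)
  let ?C = "c (Suc N)"
  have "P x - ?C ** R (Suc N) x = (\<Sum>i\<le>N. x ^ i *\<^sub>R (c i - ?C ** d i))" for x
    by (simp add: c d matrix_add_ldistrib mat2_mult_scaleR scaleR_diff_right sum_subtractf
        bounded_bilinear.sum_right[OF bounded_bilinear_mat2_mult])
  then have "(\<lambda>x. P x - ?C ** R (Suc N) x) \<in> matrix_polys N"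
    unfolding matrix_polys_def by (intro CollectI exI[of _ "\<lambda>i. c i - ?C ** d i"]) blast
  from Suc.IH[OF Suc.prems(1) this] obtain A
    where A: "\<And>x. P x - ?C ** R (Suc N) x = (\<Sum>w\<le>N. A w ** R w x)" by auto
  then have "\<forall>x. P x = (\<Sum>w\<le>Suc N. (A(Suc N := ?C)) w ** R w x)"
    by (simp add: algebra_simps diff_eq_eq cong: sum.cong_simp)
  then show ?case by blast
qed

text \<open>The matrix coefficients \<open>\<langle>Q\<^sub>w D, Q\<^sub>v\<rangle>\<close> of the operator in the orthonormal basis are exchanged by
  transposition, and with them the two variables of the kernel. That the polynomials of degree at
  most \<open>N\<close> are invariant ensures that the expansion of \<open>Q\<^sub>w D\<close> ends at \<open>v = N\<close>, exactly where the
  kernel is truncated.\<close>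

lemma kernel_symmetric_operator:
  assumes n: "n > 0"
    and Q: "\<And>w. w \<le> N \<Longrightarrow> Q w \<in> matrix_polys N"
    and orth: "\<And>w v. w \<le> N \<Longrightarrow> v \<le> N \<Longrightarrow>
      matrix_inner (weight p n) (Q w) (Q v) = (if w = v then mat 1 else 0)"
    and basis: "\<And>P. P \<in> matrix_polys N \<Longrightarrow> \<exists>A. \<forall>x. P x = (\<Sum>w\<le>N. A w ** Q w x)"
  shows "D_tilde p n \<alpha> N (kernel Q N y) x = transpose (D_tilde p n \<alpha> N (kernel Q N x) y)"
proof -
  let ?D = "D_tilde p n \<alpha> N" and ?ip = "matrix_inner (weight p n)"
  have cont: "continuous_on {-1..1} (Q w)" "continuous_on {-1..1} (?D (Q w))" if "w \<le> N" for w
    using Q[OF that] matrix_polys_continuous D_tilde_matrix_polys by blast+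
  have coeff: "?D (Q w) x = (\<Sum>v\<le>N. ?ip (?D (Q w)) (Q v) ** Q v x)" if w: "w \<le> N" for w x
  proof -
    obtain A where A: "\<And>x. ?D (Q w) x = (\<Sum>v\<le>N. A v ** Q v x)"
      using basis[OF D_tilde_matrix_polys[OF Q[OF w]]] by blast
    have "?ip (?D (Q w)) (Q u) = A u" if u: "u \<le> N" for u
    proof -
      have "?ip (?D (Q w)) (Q u) = (\<Sum>v\<le>N. ?ip (\<lambda>x. A v ** Q v x) (Q u))"
        unfolding A[abs_def] using n cont u
        by (intro matrix_inner_sum_left bounded_bilinear.continuous_on[OF bounded_bilinear_mat2_mult]) auto
      also have "\<dots> = (\<Sum>v\<le>N. if v = u then A u else 0)"
        using n cont u by (intro sum.cong) (auto simp: matrix_inner_mult_left orth)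
      also have "\<dots> = A u" using u by simp
      finally show ?thesis .
    qed
    then show ?thesis by (simp add: A)
  qed
  have sym: "transpose (?ip (?D (Q w)) (Q v)) = ?ip (?D (Q v)) (Q w)" if wv: "w \<le> N" "v \<le> N" for w v
  proof -
    have "transpose (?ip (?D (Q w)) (Q v)) = ?ip (Q v) (?D (Q w))"
      using wv by (intro matrix_inner_transpose n cont)
    also have "\<dots> = ?ip (?D (Q v)) (Q w)"
    proof -
      obtain F F' G G' where "\<And>x. (Q v has_vector_derivative F x) (at x)"
        "\<And>x. (F has_vector_derivative F' x) (at x)" "continuous_on UNIV F'"
        "\<And>x. (Q w has_vector_derivative G x) (at x)"
        "\<And>x. (G has_vector_derivative G' x) (at x)" "continuous_on UNIV G'"
        using matrix_polys_derivs[OF Q[OF wv(1)]] matrix_polys_derivs[OF Q[OF wv(2)]] by metis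
      from D_tilde_symmetric[OF n this(1,2,4,5,3,6)] show ?thesis by simp
    qed
    finally show ?thesis .
  qed
  have ker: "?D (kernel Q N x) y = (\<Sum>w\<le>N. \<Sum>v\<le>N. transpose (Q w x) ** ?ip (?D (Q w)) (Q v) ** Q v y)" for x y
  proof -
    have "?D (kernel Q N x) y = (\<Sum>w\<le>N. transpose (Q w x) ** ?D (Q w) y)"
      unfolding kernel_def[abs_def] using Q by (intro D_tilde_sum_mult) auto
    then show ?thesis
      by (simp add: coeff matrix_mul_assoc bounded_bilinear.sum_right[OF bounded_bilinear_mat2_mult])
  qed
  have "transpose (?D (kernel Q N x) y)
      = (\<Sum>w\<le>N. \<Sum>v\<le>N. transpose (transpose (Q w x) ** ?ip (?D (Q w)) (Q v) ** Q v y))"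
    unfolding ker linear_sum[OF bounded_linear.linear[OF bounded_linear_transpose]] ..
  also have "\<dots> = (\<Sum>w\<le>N. \<Sum>v\<le>N. transpose (Q v y) ** ?ip (?D (Q v)) (Q w) ** Q w x)"
    by (intro sum.cong refl) (simp add: matrix_transpose_mul matrix_mul_assoc sym)
  also have "\<dots> = ?D (kernel Q N y) x"
    unfolding ker by (rule sum.swap)
  finally show ?thesis by simp
qed

text \<open>With \<open>S = \<parallel>R\<^sub>w\<parallel>\<close> symmetric and \<open>S S = \<langle>R\<^sub>w, R\<^sub>w\<rangle>\<close>, the inverse \<open>T\<close> of \<open>S\<close> gives
  \<open>\<langle>T R\<^sub>w, T R\<^sub>w\<rangle> = T S S T\<^sup>* = 1\<close>.\<close>

lemma orthonormalize_orthonormal: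
  assumes p: "0 < p" "p < n" and R: "monic_orthogonal_polys (weight p n) R"
  shows "matrix_norm (weight p n) (R w) ** orthonormalize (weight p n) R w x = R w x"
    and "matrix_inner (weight p n) (orthonormalize (weight p n) R w) (orthonormalize (weight p n) R v)
      = (if w = v then mat 1 else 0)"
proof -
  let ?ip = "matrix_inner (weight p n)"
  define S where "S w = matrix_norm (weight p n) (R w)" for w
  define T where "T w = matrix_inv (S w)" for w
  have n: "n > 0" using p by simp
  have mon: "monic_matrix_poly w (R w)" for w using R by (simp add: monic_orthogonal_polys_def)
  have S: "pos_def (S w)" "S w ** S w = ?ip (R w) (R w)" for w
    using pos_def_sqrt_works[OF matrix_inner_monic_pos_def[OF p mon[of w]]]
    by (simp_all add: S_def matrix_norm_def)
  have "invertible (S w)" for w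
    using S(1)[of w] pos_def_mat2_iff by (simp add: invertible_det_nz)
  then have T: "S w ** T w = mat 1" "T w ** S w = mat 1" for w
    unfolding T_def matrix_inv_def invertible_def by (rule someI2_ex; simp)+
  have QT: "orthonormalize (weight p n) R w = (\<lambda>x. T w ** R w x)" for w
    by (simp add: orthonormalize_def T_def S_def fun_eq_iff)
  show "matrix_norm (weight p n) (R w) ** orthonormalize (weight p n) R w x = R w x"
    using T[of w] by (simp add: QT S_def matrix_mul_assoc)
  have cont: "continuous_on {-1..1} (R w)" for w
    using matrix_polys_continuous monic_matrix_poly_in[OF mon] by blast
  have "?ip (\<lambda>x. T w ** R w x) (\<lambda>x. T v ** R v x) = T w ** ?ip (R w) (R v) ** transpose (T v)"
    using n cont bounded_bilinear.continuous_on[OF bounded_bilinear_mat2_mult continuous_on_const cont]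
    by (simp add: matrix_inner_mult_left matrix_inner_mult_right matrix_mul_assoc)
  also have "\<dots> = (if w = v then mat 1 else 0)"
  proof (cases "w = v")
    case True
    have "transpose (S v) = S v" using S(1) by (simp add: pos_def_def)
    then have "S v ** transpose (T v) = mat 1"
      using T(2)[of v] by (metis matrix_transpose_mul transpose_mat)
    then show ?thesis using True T(2)[of v] S(2)[of v, symmetric]
      by (simp add: matrix_mul_assoc)
  next
    case False
    then show ?thesis using R by (simp add: monic_orthogonal_polys_def)
  qed
  finally show "?ip (orthonormalize (weight p n) R w) (orthonormalize (weight p n) R v)
      = (if w = v then mat 1 else 0)"
    by (simp add: QT)
qed

theorem theorem3p4:
  fixes n p \<alpha> :: real and N :: nat
    and R Q :: "nat \<Rightarrow> real \<Rightarrow> real^2^2"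
    and k :: "real \<Rightarrow> real \<Rightarrow> real^2^2"
  assumes "0 < p" and "p < n"
    and "\<alpha> \<in> {-1<..<1}"
    and "monic_orthogonal_polys (weight p n) R"
    and "Q = orthonormalize (weight p n) R"
    and "k = kernel Q N"
  shows "\<forall>x y. D_tilde p n \<alpha> N (\<lambda>s. transpose (k s y)) x
             = transpose (D_tilde p n \<alpha> N (\<lambda>t. k x t) y)"
proof (intro allI)
  fix x y
  let ?S = "\<lambda>w. matrix_norm (weight p n) (R w)"
  note orth = orthonormalize_orthonormal[OF assms(1,2,4), folded assms(5)]
  have mon: "monic_matrix_poly w (R w)" for w using assms(4) by (simp add: monic_orthogonal_polys_def)
  have Q: "Q w \<in> matrix_polys N" if "w \<le> N" for w
    unfolding assms(5) orthonormalize_def[abs_def]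
    using that by (intro matrix_polys_mult matrix_polys_mono[OF monic_matrix_poly_in[OF mon]])
  have basis: "\<exists>A. \<forall>x. P x = (\<Sum>w\<le>N. A w ** Q w x)" if P: "P \<in> matrix_polys N" for P
  proof -
    obtain A where "\<And>x. P x = (\<Sum>w\<le>N. A w ** R w x)"
      using matrix_polys_expansion[OF mon P] by blast
    then have "\<forall>x. P x = (\<Sum>w\<le>N. (A w ** ?S w) ** Q w x)"
      by (simp add: orth(1) matrix_mul_assoc[symmetric])
    then show ?thesis by (intro exI[of _ "\<lambda>w. A w ** ?S w"])
  qed
  have "(\<lambda>s. transpose (k s y)) = kernel Q N y"
    unfolding assms(6) kernel_def linear_sum[OF bounded_linear.linear[OF bounded_linear_transpose]]
    by (simp add: matrix_transpose_mul)
  moreover have "D_tilde p n \<alpha> N (kernel Q N y) x = transpose (D_tilde p n \<alpha> N (kernel Q N x) y)"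
    using assms(1,2) Q orth(2) basis by (intro kernel_symmetric_operator) auto
  ultimately show "D_tilde p n \<alpha> N (\<lambda>s. transpose (k s y)) x
      = transpose (D_tilde p n \<alpha> N (\<lambda>t. k x t) y)"
    by (simp add: assms(6))
qed

end
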